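(* Let $p \in [3,\infty)$. Suppose that for every $\epsilon > 0$ there exist constants $K = K(\epsilon) > 1$ and $C_\epsilon < \infty$ such that for all $R \geq 1$ and all $f \in L^\infty(\mathbb{P})$, $$\left\lVert \mathrm{Br}_{K^{-\epsilon}} Ef \right\rVert_{L^p(B_R)} \leq C_{\epsilon} R^{\epsilon} \|f\|_{2}^{12/13} \|f\|_{\infty}^{1/13},$$ where the broad part $\mathrm{Br}_{K^{-\epsilon}} Ef$ is defined with respect to the partition of $\mathbb{P}$ into $K^{-1}$-caps with $K = K(\epsilon)$, and suppose that $\lim_{\epsilon \to 0} K(\epsilon) = \infty$. Then $p \geq 13/4$.
   Context: Let $\mathbb{P} = \{(x_1,x_2,x_1^2+x_2^2) : (x_1,x_2) \in B_2(0,1)\} \subset \mathbb{R}^3$ be the truncated paraboloid, i.e. the paraboloid graphed over the unit ball of $\mathbb{R}^2$, with surface measure $d\mathrm{vol}_{\mathbb{P}}$. The norms $\|f\|_2$ and $\|f\|_\infty$ are the $L^2$ and $L^\infty$ norms on $\mathbb{P}$ with respect to this measure. The extension operator is $$Ef(x) = \int_{\mathbb{P}} e^{i \omega\cdot x} f(\omega)\, d\mathrm{vol}_{\mathbb{P}}(\omega), \qquad x \in \mathbb{R}^3.$$ $B_R$ denotes the ball of radius $R$ in $\mathbb{R}^3$ centred at the origin. For each $K > 1$, $\mathbb{P}$ is partitioned into $K^{-1}$-caps $\tau$, i.e. disjoint pieces of $\mathbb{P}$ of diameter $\sim K^{-1}$, each being the graph over a region of $B_2(0,1)$ comparable to a disc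 of radius $K^{-1}$ (all implicit constants are absolute). For a function $f$ on $\mathbb{P}$ and a cap $\tau$, write $f_\tau = f \chi_\tau$, where $\chi_\tau$ is the indicator function of $\tau$. Given $K>1$ and $\epsilon>0$, a point $x \in \mathbb{R}^3$ is called $K^{-\epsilon}$-broad for $Ef$ if for every $K^{-1}$-cap $\tau$ in the partition, $$|Ef_\tau(x)| \leq K^{-\epsilon} |Ef(x)|.$$ The broad part of $Ef$ is defined by $\mathrm{Br}_{K^{-\epsilon}} Ef(x) = |Ef(x)|$ if $x$ is $K^{-\epsilon}$-broad for $Ef$, and $\mathrm{Br}_{K^{-\epsilon}} Ef(x) = 0$ otherwise. *)

theory Defs
  imports "HOL-Analysis.Analysis" "HOL-Probability.Essential_Supremum"
begin

section \<open>The truncated paraboloid and its surface measure\<close>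

definition paraboloid_graph :: "real^2 \<Rightarrow> real^3" where
  "paraboloid_graph y = vector [y$1, y$2, (y$1)\<^sup>2 + (y$2)\<^sup>2]"

definition paraboloid :: "(real^3) set" where
  "paraboloid = paraboloid_graph ` ball 0 1"

text \<open>
  The surface area element of the graph of \<open>\<phi>\<close> is \<open>sqrt (1 + |\<nabla>\<phi>(y)|\<^sup>2) dy\<close>;
  here \<open>\<phi>(y) = |y|\<^sup>2\<close> and \<open>\<nabla>\<phi>(y) = 2 y\<close>.  The underlying space is the paraboloid itself,
  so values of functions outside it never matter.
\<close>

definition vol_paraboloid :: "(real^3) measure" where
  "vol_paraboloid =
     distr (density (restrict_space lborel (ball 0 1))
              (\<lambda>y :: real^2. ennreal (sqrt (1 + (2 * norm y)\<^sup>2))))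
           (restrict_space borel paraboloid) paraboloid_graph"

section \<open>Norms\<close>

text \<open>
  The norms take values in \<open>[0,\<infinity>]\<close>, so that an infinite norm is not confused with zero.
  The power function is only used with positive exponents.
\<close>

definition ennreal_powr :: "ennreal \<Rightarrow> real \<Rightarrow> ennreal" where
  "ennreal_powr x a = (if x = \<infinity> then \<infinity> else ennreal (enn2real x powr a))"

definition Lp_norm :: "real \<Rightarrow> 'a measure \<Rightarrow> ('a \<Rightarrow> 'b::real_normed_vector) \<Rightarrow> ennreal" where
  "Lp_norm p M f = ennreal_powr (\<integral>\<^sup>+ x. ennreal (norm (f x) powr p) \<partial>M) (1 / p)"

definition Linf_norm :: "'a measure \<Rightarrow> ('a \<Rightarrow> 'b::real_normed_vector) \<Rightarrow> ennreal" where
  "Linf_norm M f = esssup M (\<lambda>x. ennreal (norm (f x)))"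

definition Linf :: "'a measure \<Rightarrow> ('a \<Rightarrow> 'b::real_normed_vector) set" where
  "Linf M = {f \<in> borel_measurable M. Linf_norm M f < \<infinity>}"

section \<open>The extension operator, caps, and the broad part\<close>

definition ext_op :: "(real^3 \<Rightarrow> complex) \<Rightarrow> real^3 \<Rightarrow> complex" where
  "ext_op f x = (\<integral>\<omega>. exp (\<i> * complex_of_real (\<omega> \<bullet> x)) * f \<omega> \<partial>vol_paraboloid)"

text \<open>
  \<open>a\<close> and \<open>A\<close> are the lower and upper implicit constants in "of diameter comparable to \<open>1/K\<close>"
  and "graph over a region comparable to a disc of radius \<open>1/K\<close>".
\<close>

definition is_cap :: "real \<Rightarrow> real \<Rightarrow> real \<Rightarrow> (real^3) set \<Rightarrow> bool" where
  "is_cap a A K \<tau> \<longleftrightarrow>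
     \<tau> \<in> sets borel \<and>
     a / K \<le> diameter \<tau> \<and> diameter \<tau> \<le> A / K \<and>
     (\<exists>D \<subseteq> ball 0 1. \<tau> = paraboloid_graph ` D \<and>
        (\<exists>w. ball w (a / K) \<subseteq> D \<and> D \<subseteq> ball w (A / K)))"

definition is_cap_partition :: "real \<Rightarrow> real \<Rightarrow> real \<Rightarrow> (real^3) set set \<Rightarrow> bool" where
  "is_cap_partition a A K T \<longleftrightarrow> partition_on paraboloid T \<and> (\<forall>\<tau>\<in>T. is_cap a A K \<tau>)"

definition restrict_to_cap :: "(real^3) set \<Rightarrow> (real^3 \<Rightarrow> complex) \<Rightarrow> real^3 \<Rightarrow> complex" where
  "restrict_to_cap \<tau> f = (\<lambda>\<omega>. f \<omega> * indicator \<tau> \<omega>)"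

definition is_broad :: "(real^3) set set \<Rightarrow> real \<Rightarrow> real \<Rightarrow> (real^3 \<Rightarrow> complex) \<Rightarrow> real^3 \<Rightarrow> bool" where
  "is_broad T K \<epsilon> f x \<longleftrightarrow>
     (\<forall>\<tau>\<in>T. norm (ext_op (restrict_to_cap \<tau> f) x) \<le> K powr (-\<epsilon>) * norm (ext_op f x))"

definition broad_part :: "(real^3) set set \<Rightarrow> real \<Rightarrow> real \<Rightarrow> (real^3 \<Rightarrow> complex) \<Rightarrow> real^3 \<Rightarrow> real" where
  "broad_part T K \<epsilon> f x = (if is_broad T K \<epsilon> f x then norm (ext_op f x) else 0)"

end

theory Submission
  imports Defs
begin

text \<open>
The estimate is tested on randomly signed functions supported over a thin strip of the paraboloid.
Let \<open>R = M\<^sup>2\<close>.  The strip of length \<open>1/2\<close> and width \<open>1 / (2 M)\<close> in the unit disc is cut into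
\<open>M\<^sup>2\<close> cells of length \<open>1 / (2 M\<^sup>2)\<close>, and \<open>f\<close> equals \<open>\<plusminus>1\<close> on each cell, divided by the surface area
element so that \<open>Ef\<close> is an integral against Lebesgue measure on the disc.  On a slab inside \<open>B\<^sub>R\<close> of
dimensions comparable to \<open>R \<times> R\<^sup>1\<^sup>/\<^sup>2 \<times> R\<close> the phase \<open>\<omega> \<bullet> x\<close> moves by less than \<open>1/2\<close> on each
cell (\<open>phase_almost_constant\<close>).  So every cell contributes at least half of its area to
\<open>Ef(x)\<close> in absolute value, and with random signs the contributions add up in square mean:
\<open>|Ef(x)|\<^sup>2\<close> has mean comparable to \<open>M\<^sup>2 (M\<^sup>-\<^sup>3)\<^sup>2 = R\<^sup>-\<^sup>2\<close> throughout the slab.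

Such an \<open>Ef\<close> is broad at a typical point.  A cap \<open>\<tau>\<close> meets only a fraction of order \<open>1/K\<close> of
the strip, so the mean of \<open>|Ef\<^sub>\<tau>|\<^sup>2\<close> is \<open>O(1/K)\<close> times that of \<open>|Ef|\<^sup>2\<close>, and Khinchin's inequality for
fourth moments bounds the mean of \<open>\<Sum>\<^sub>\<tau> |Ef\<^sub>\<tau>|\<^sup>4\<close> by \<open>O(1/K)\<close> times the squared mean of \<open>|Ef|\<^sup>2\<close>.
Where \<open>x\<close> is not broad, \<open>|Ef|\<^sup>4 \<le> K\<^sup>4\<^sup>\<epsilon> \<Sum>\<^sub>\<tau> |Ef\<^sub>\<tau>|\<^sup>4\<close>.  Hence for small \<open>\<epsilon>\<close> and large \<open>K\<close> at
least half of the mean of \<open>|Ef|\<^sup>2\<close> comes from signs for which \<open>x\<close> is broad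
(\<open>broad_second_moment\<close>).

Averaging over the slab, of volume \<open>M\<^sup>5 / 64\<close>, gives a choice of signs with
\<open>\<parallel>Br Ef\<parallel>\<^sub>p\<close> at least of order \<open>M\<^bsup>5/p - 2\<^esup>\<close> (\<open>exists_signs_broad_large\<close>).  On the other side
\<open>\<parallel>f\<parallel>\<^sub>2\<close> is at most of order \<open>M\<^bsup>-1/2\<^esup>\<close> and \<open>\<parallel>f\<parallel>\<^sub>\<infinity> \<le> 1\<close>.  The estimate therefore forces
\<open>5/p - 2 \<le> 2 \<epsilon> - 6/13\<close>, and \<open>\<epsilon> \<rightarrow> 0\<close> gives \<open>5/p \<le> 20/13\<close>, which is \<open>p \<ge> 13/4\<close>.
\<close>

section \<open>Sums with random signs\<close>

text \<open>
A choice of signs is the set \<open>S\<close> of indices that carry the sign \<open>+1\<close>; averages over random signs are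
sums over all subsets of the index set \<open>J\<close>.
\<close>

definition rademacher_sum :: "'i set \<Rightarrow> 'i set \<Rightarrow> ('i \<Rightarrow> 'a::real_inner) \<Rightarrow> 'a" where
  "rademacher_sum J S b = (\<Sum>j\<in>J. (if j \<in> S then 1 else - 1) *\<^sub>R b j)"

lemma sum_Pow_insert:
  fixes F :: "'i set \<Rightarrow> 'b::comm_monoid_add"
  assumes "finite J" "a \<notin> J"
  shows "(\<Sum>S\<in>Pow (insert a J). F S) = (\<Sum>S\<in>Pow J. F S + F (insert a S))"
proof -
  have inj: "inj_on (insert a) (Pow J)"
    using assms(2) by (auto simp: inj_on_def)
  have "(\<Sum>S\<in>Pow (insert a J). F S) = (\<Sum>S\<in>Pow J. F S) + (\<Sum>S\<in>insert a ` Pow J. F S)"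
    unfolding Pow_insert using assms by (intro sum.union_disjoint) auto
  then show ?thesis
    by (simp add: sum.reindex[OF inj] sum.distrib)
qed

lemma rademacher_sum_insert:
  assumes "finite J" "a \<notin> J" "S \<subseteq> J"
  shows "rademacher_sum (insert a J) S b = rademacher_sum J S b - b a"
    and "rademacher_sum (insert a J) (insert a S) b = rademacher_sum J S b + b a"
proof -
  have "(\<Sum>j\<in>J. (if j \<in> insert a S then 1 else - 1) *\<^sub>R b j) = rademacher_sum J S b"
    unfolding rademacher_sum_def using assms by (intro sum.cong) auto
  with assms show "rademacher_sum (insert a J) (insert a S) b = rademacher_sum J S b + b a"
    by (simp add: rademacher_sum_def add.commute)
  have "a \<notin> S" using assms by auto
  with assms show "rademacher_sum (insert a J) S b = rademacher_sum J S b - b a"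
    by (simp add: rademacher_sum_def)
qed

text \<open>
Orthogonality of the signs, one index at a time: both values of a new sign together give the
parallelogram law.
\<close>

lemma rademacher_second_moment:
  assumes "finite J"
  shows "(\<Sum>S\<in>Pow J. (norm (rademacher_sum J S b))\<^sup>2) = 2 ^ card J * (\<Sum>j\<in>J. (norm (b j))\<^sup>2)"
  using assms
proof (induction J rule: finite_induct)
  case empty
  then show ?case by (simp add: rademacher_sum_def)
next
  case (insert a J)
  have "(norm (z - b a))\<^sup>2 + (norm (z + b a))\<^sup>2 = 2 * (norm z)\<^sup>2 + 2 * (norm (b a))\<^sup>2" for z
    by (simp add: power2_norm_eq_inner algebra_simps inner_commute)
  then have "(\<Sum>S\<in>Pow (insert a J). (norm (rademacher_sum (insert a J) S b))\<^sup>2)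
      = (\<Sum>S\<in>Pow J. 2 * (norm (rademacher_sum J S b))\<^sup>2 + 2 * (norm (b a))\<^sup>2)"
    using insert by (simp add: sum_Pow_insert rademacher_sum_insert)
  also have "\<dots> = 2 ^ card (insert a J) * (\<Sum>j\<in>insert a J. (norm (b j))\<^sup>2)"
    using insert by (simp add: sum.distrib sum_distrib_left[symmetric] card_Pow algebra_simps)
  finally show ?case .
qed

text \<open>
Khinchin's inequality for the fourth moment, by induction on the index set.  Adding one more vector
of square norm \<open>\<beta>\<close> turns \<open>W\<close> into \<open>W + \<beta>\<close>, and the mean of the fourth power grows by at most
\<open>6 \<beta> W + \<beta>\<^sup>2 \<le> 3 ((W + \<beta>)\<^sup>2 - W\<^sup>2)\<close>.
\<close>

lemma rademacher_fourth_moment: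
  assumes "finite J"
  shows "(\<Sum>S\<in>Pow J. (norm (rademacher_sum J S b)) ^ 4)
           \<le> 2 ^ card J * (3 * (\<Sum>j\<in>J. (norm (b j))\<^sup>2)\<^sup>2)"
  using assms
proof (induction J rule: finite_induct)
  case empty
  then show ?case by (simp add: rademacher_sum_def)
next
  case (insert a J)
  define \<beta> where "\<beta> = (norm (b a))\<^sup>2"
  define W where "W = (\<Sum>j\<in>J. (norm (b j))\<^sup>2)"
  have step: "norm (z - b a) ^ 4 + norm (z + b a) ^ 4
      \<le> 2 * norm z ^ 4 + 12 * \<beta> * (norm z)\<^sup>2 + 2 * \<beta>\<^sup>2" for z
  proof -
    have p4: "t ^ 4 = (t\<^sup>2)\<^sup>2" for t :: real by simp
    have e: "(norm (z - b a))\<^sup>2 = (norm z)\<^sup>2 + \<beta> - 2 * (z \<bullet> b a)"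
      "(norm (z + b a))\<^sup>2 = (norm z)\<^sup>2 + \<beta> + 2 * (z \<bullet> b a)"
      by (simp_all add: \<beta>_def power2_norm_eq_inner algebra_simps inner_commute)
    have "(z \<bullet> b a)\<^sup>2 \<le> (norm z)\<^sup>2 * \<beta>"
      unfolding \<beta>_def by (metis Cauchy_Schwarz_ineq power2_norm_eq_inner)
    then show ?thesis
      unfolding p4 e by (simp add: power2_eq_square algebra_simps)
  qed
  have "(\<Sum>S\<in>Pow (insert a J). (norm (rademacher_sum (insert a J) S b)) ^ 4)
      = (\<Sum>S\<in>Pow J. norm (rademacher_sum J S b - b a) ^ 4 + norm (rademacher_sum J S b + b a) ^ 4)"
    using insert by (simp add: sum_Pow_insert rademacher_sum_insert)
  also have "\<dots> \<le> (\<Sum>S\<in>Pow J. 2 * norm (rademacher_sum J S b) ^ 4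
                   + 12 * \<beta> * (norm (rademacher_sum J S b))\<^sup>2 + 2 * \<beta>\<^sup>2)"
    by (intro sum_mono step)
  also have "\<dots> = 2 * (\<Sum>S\<in>Pow J. norm (rademacher_sum J S b) ^ 4)
                   + 12 * \<beta> * (2 ^ card J * W) + 2 ^ card J * (2 * \<beta>\<^sup>2)"
    using insert.hyps
    by (simp add: sum.distrib sum_distrib_left[symmetric] card_Pow rademacher_second_moment W_def)
  also have "\<dots> \<le> 2 * (2 ^ card J * (3 * W\<^sup>2)) + 12 * \<beta> * (2 ^ card J * W) + 2 ^ card J * (6 * \<beta>\<^sup>2)"
    using insert.IH by (intro add_mono mult_left_mono) (auto simp: W_def \<beta>_def)
  also have "\<dots> = 2 ^ card (insert a J) * (3 * (\<beta> + W)\<^sup>2)"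
    using insert.hyps by (simp add: power2_eq_square algebra_simps)
  also have "\<beta> + W = (\<Sum>j\<in>insert a J. (norm (b j))\<^sup>2)"
    using insert.hyps by (simp add: \<beta>_def W_def)
  finally show ?case .
qed

text \<open>
If the pieces \<open>c \<tau>\<close> of a random sum have small energies in the sense of \<open>\<ell>\<^sup>2\<close>, then at least half of the
second moment of the sum comes from signs for which every piece is dominated by \<open>k\<close> times the sum.
For the other signs some piece satisfies \<open>k Z < Y\<^sub>\<tau>\<close>, so \<open>Z\<^sup>4 \<le> k\<^sup>-\<^sup>4 \<Sum>\<^sub>\<tau> Y\<^sub>\<tau>\<^sup>4\<close>; their share of the
second moment is controlled by the fourth moments of the pieces through \<open>Z\<^sup>2 \<le> Z\<^sup>4 / W + W / 4\<close>.
Summing fourth moments over the pieces replaces a union bound, and so no count of the pieces occurs.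
\<close>

lemma broad_second_moment:
  fixes b :: "'i \<Rightarrow> 'a::real_inner" and c :: "'c \<Rightarrow> 'i \<Rightarrow> 'a"
  assumes J: "finite J" and k: "k > 0"
    and small: "\<And>T'. finite T' \<Longrightarrow> T' \<subseteq> T \<Longrightarrow>
        12 * (\<Sum>\<tau>\<in>T'. (\<Sum>j\<in>J. (norm (c \<tau> j))\<^sup>2)\<^sup>2) \<le> k ^ 4 * (\<Sum>j\<in>J. (norm (b j))\<^sup>2)\<^sup>2"
  shows "2 ^ card J * (\<Sum>j\<in>J. (norm (b j))\<^sup>2) / 2
    \<le> (\<Sum>S\<in>Pow J. (if \<forall>\<tau>\<in>T. norm (rademacher_sum J S (c \<tau>)) \<le> k * norm (rademacher_sum J S b)
                      then norm (rademacher_sum J S b) else 0)\<^sup>2)"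
proof -
  define W where "W = (\<Sum>j\<in>J. (norm (b j))\<^sup>2)"
  define Z where "Z S = norm (rademacher_sum J S b)" for S
  define Y where "Y \<tau> S = norm (rademacher_sum J S (c \<tau>))" for \<tau> S
  define br where "br S = (if \<forall>\<tau>\<in>T. Y \<tau> S \<le> k * Z S then Z S else 0)" for S
  \<comment> \<open>Each bad choice of signs needs only one offending piece, so finitely many pieces suffice even if \<open>T\<close> is infinite.\<close>
  define pick where "pick S = (SOME \<tau>. \<tau> \<in> T \<and> k * Z S < Y \<tau> S)" for S
  define T' where "T' = pick ` {S \<in> Pow J. \<exists>\<tau>\<in>T. k * Z S < Y \<tau> S}"
  have pick: "pick S \<in> T \<and> k * Z S < Y (pick S) S" if "\<exists>\<tau>\<in>T. k * Z S < Y \<tau> S" for S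
    unfolding pick_def using that by (intro someI_ex[of "\<lambda>\<tau>. \<tau> \<in> T \<and> k * Z S < Y \<tau> S"]) auto
  have T': "finite T'" "T' \<subseteq> T"
    using J pick by (auto simp: T'_def)
  show ?thesis
  proof (cases "W = 0")
    case True
    then show ?thesis by (simp add: W_def[symmetric] sum_nonneg)
  next
    case False
    then have W: "W > 0"
      by (simp add: W_def sum_nonneg order_le_neq_trans)
    have pointwise: "(Z S)\<^sup>2 - W / 4 - (\<Sum>\<tau>\<in>T'. Y \<tau> S ^ 4) / (k ^ 4 * W) \<le> (br S)\<^sup>2"
      if S: "S \<in> Pow J" for S
    proof (cases "\<forall>\<tau>\<in>T. Y \<tau> S \<le> k * Z S")
      case True
      then show ?thesis
        using W k by (simp add: br_def) (smt (verit) divide_nonneg_pos mult_pos_pos sum_nonneg zero_le_even_power even_numeral zero_less_power)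
    next
      case False
      then have bad: "\<exists>\<tau>\<in>T. k * Z S < Y \<tau> S" by force
      then have "pick S \<in> T'" using S by (auto simp: T'_def)
      have "(k * Z S) ^ 4 \<le> Y (pick S) S ^ 4"
        using pick[OF bad] k by (intro power_mono) (auto simp: Z_def)
      also have "\<dots> \<le> (\<Sum>\<tau>\<in>T'. Y \<tau> S ^ 4)"
        using T' \<open>pick S \<in> T'\<close> by (intro member_le_sum) auto
      finally have "Z S ^ 4 / W \<le> (\<Sum>\<tau>\<in>T'. Y \<tau> S ^ 4) / (k ^ 4 * W)"
        using k W by (simp add: power_mult_distrib divide_simps mult.commute)
      moreover have "(Z S)\<^sup>2 \<le> Z S ^ 4 / W + W / 4"
      proof -
        have "0 \<le> ((Z S)\<^sup>2 - W / 2)\<^sup>2" by simp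
        then have "(Z S)\<^sup>2 * W \<le> Z S ^ 4 + W\<^sup>2 / 4"
          by (simp add: power2_eq_square power4_eq_xxxx algebra_simps)
        then show ?thesis using W by (simp add: field_simps power2_eq_square)
      qed
      moreover have "br S = 0" using False by (auto simp: br_def)
      ultimately show ?thesis by simp
    qed
    have "12 * (\<Sum>S\<in>Pow J. \<Sum>\<tau>\<in>T'. Y \<tau> S ^ 4) = 12 * (\<Sum>\<tau>\<in>T'. \<Sum>S\<in>Pow J. Y \<tau> S ^ 4)"
      by (subst sum.swap) simp
    also have "\<dots> \<le> 12 * (\<Sum>\<tau>\<in>T'. 2 ^ card J * (3 * (\<Sum>j\<in>J. (norm (c \<tau> j))\<^sup>2)\<^sup>2))"
      unfolding Y_def by (intro mult_left_mono sum_mono rademacher_fourth_moment J) auto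
    also have "\<dots> = 3 * 2 ^ card J * (12 * (\<Sum>\<tau>\<in>T'. (\<Sum>j\<in>J. (norm (c \<tau> j))\<^sup>2)\<^sup>2))"
      by (simp add: sum_distrib_left algebra_simps)
    also have "\<dots> \<le> 3 * 2 ^ card J * (k ^ 4 * W\<^sup>2)"
      unfolding W_def by (intro mult_left_mono small T') auto
    finally have Y: "(\<Sum>S\<in>Pow J. \<Sum>\<tau>\<in>T'. Y \<tau> S ^ 4) / (k ^ 4 * W) \<le> 2 ^ card J * W / 4"
      using k W by (simp add: divide_simps power2_eq_square algebra_simps)
    have "2 ^ card J * W / 2 = 2 ^ card J * W - 2 ^ card J * W / 4 - 2 ^ card J * W / 4"
      by simp
    also have "\<dots> \<le> 2 ^ card J * W - 2 ^ card J * W / 4 - (\<Sum>S\<in>Pow J. \<Sum>\<tau>\<in>T'. Y \<tau> S ^ 4) / (k ^ 4 * W)"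
      using Y by linarith
    also have "\<dots> = (\<Sum>S\<in>Pow J. (Z S)\<^sup>2 - W / 4 - (\<Sum>\<tau>\<in>T'. Y \<tau> S ^ 4) / (k ^ 4 * W))"
      using J by (simp add: sum_subtractf Z_def rademacher_second_moment W_def[symmetric] card_Pow sum_divide_distrib)
    also have "\<dots> \<le> (\<Sum>S\<in>Pow J. (br S)\<^sup>2)"
      by (intro sum_mono pointwise)
    finally show ?thesis unfolding W_def br_def Y_def Z_def .
  qed
qed

text \<open>
Second moments pass to \<open>p\<close>-th moments through this pointwise bound, which takes the place of Jensen's
inequality: for \<open>u = t\<^sup>2 / l\<^sup>2\<close> it says \<open>u\<^bsup>p/2\<^esup> \<ge> u - 1\<close>.
\<close>

lemma powr_ge_quadratic:
  fixes t :: real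
  assumes "0 \<le> t" "0 < l" "2 \<le> p"
  shows "l powr p * (t\<^sup>2 / l\<^sup>2 - 1) \<le> t powr p"
proof (cases "t \<le> l")
  case True
  then have "t\<^sup>2 / l\<^sup>2 - 1 \<le> 0"
    using assms by (simp add: power_mono)
  then have "l powr p * (t\<^sup>2 / l\<^sup>2 - 1) \<le> 0"
    by (simp add: mult_nonneg_nonpos)
  then show ?thesis by (smt (verit) powr_ge_zero)
next
  case False
  then have "(t / l) powr 2 \<le> (t / l) powr p"
    using assms by (intro powr_mono) auto
  then have "t\<^sup>2 / l\<^sup>2 \<le> t powr p / l powr p"
    using assms False by (simp add: powr_divide)
  then show ?thesis
    using assms by (simp add: field_simps) (smt (verit) powr_ge_zero zero_le_power2 mult_nonneg_nonneg)
qed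

section \<open>Integration over the paraboloid\<close>

lemma borel_measurable_vec_nth [measurable]: "(\<lambda>y::real^'n. y $ i) \<in> borel_measurable borel"
  by (intro borel_measurable_continuous_onI continuous_intros)

lemma borel_measurable_vec_componentwise:
  fixes f :: "'a \<Rightarrow> real^'n"
  assumes "\<And>i. (\<lambda>x. f x $ i) \<in> borel_measurable M"
  shows "f \<in> borel_measurable M"
  using assms
  by (subst borel_measurable_euclidean_space) (auto simp: Basis_vec_def inner_axis)

lemma measurable_paraboloid_graph [measurable]: "paraboloid_graph \<in> borel_measurable borel"
proof (rule borel_measurable_vec_componentwise)
  fix i :: 3
  have "i = 1 \<or> i = 2 \<or> i = 3" by (rule exhaust_3)
  then show "(\<lambda>y. paraboloid_graph y $ i) \<in> borel_measurable borel"
    by (auto simp: paraboloid_graph_def)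
qed

definition horizontal :: "real^3 \<Rightarrow> real^2" where
  "horizontal \<omega> = vector [\<omega>$1, \<omega>$2]"

lemma measurable_horizontal [measurable]: "horizontal \<in> borel_measurable borel"
proof (rule borel_measurable_vec_componentwise)
  fix i :: 2
  have "i = 1 \<or> i = 2" by (rule exhaust_2)
  then show "(\<lambda>y. horizontal y $ i) \<in> borel_measurable borel"
    by (auto simp: horizontal_def)
qed

lemma horizontal_paraboloid_graph [simp]: "horizontal (paraboloid_graph y) = y"
  by (simp add: horizontal_def paraboloid_graph_def vec_eq_iff forall_2)

lemma inj_paraboloid_graph: "inj paraboloid_graph"
  by (metis horizontal_paraboloid_graph injI)

lemma sets_vol_paraboloid [simp]: "sets vol_paraboloid = sets (restrict_space borel paraboloid)"
  by (simp add: vol_paraboloid_def)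

lemma measurable_vol_paraboloid: "f \<in> borel_measurable borel \<Longrightarrow> f \<in> borel_measurable vol_paraboloid"
  by (subst measurable_cong_sets[OF sets_vol_paraboloid refl]) (rule measurable_restrict_space1)

lemma measurable_paraboloid_graph_restrict:
  "paraboloid_graph \<in> density (restrict_space lborel (ball 0 1)) g \<rightarrow>\<^sub>M restrict_space borel paraboloid"
proof -
  have "paraboloid_graph \<in> restrict_space lborel (ball 0 1) \<rightarrow>\<^sub>M restrict_space borel paraboloid"
    by (rule measurable_restrict_space2)
       (auto simp: paraboloid_def space_restrict_space intro!: measurable_restrict_space1)
  then show ?thesis by simp
qed

lemma measurable_restrict_lborel:
  "f \<in> borel_measurable borel \<Longrightarrow> f \<in> borel_measurable (restrict_space lborel D)"
  by (rule measurable_restrict_space1) simp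

text \<open>
Measurability of \<open>g\<close> on all of \<open>\<real>\<^sup>3\<close> keeps the subspace structure on the paraboloid out of sight in
all later arguments.
\<close>

lemma integral_vol_paraboloid:
  fixes g :: "real^3 \<Rightarrow> complex"
  assumes g [measurable]: "g \<in> borel_measurable borel"
  shows "(\<integral>\<omega>. g \<omega> \<partial>vol_paraboloid)
    = (LINT y:ball 0 1|lborel. sqrt (1 + (2 * norm y)\<^sup>2) *\<^sub>R g (paraboloid_graph y))"
proof -
  have "g \<in> borel_measurable (restrict_space borel paraboloid)"
    by (intro measurable_restrict_space1 g)
  then have "(\<integral>\<omega>. g \<omega> \<partial>vol_paraboloid) = (\<integral>y. g (paraboloid_graph y)
      \<partial>density (restrict_space lborel (ball 0 1)) (\<lambda>y. ennreal (sqrt (1 + (2 * norm y)\<^sup>2))))"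
    unfolding vol_paraboloid_def
    by (intro integral_distr measurable_paraboloid_graph_restrict)
  also have "\<dots> = (\<integral>y. sqrt (1 + (2 * norm y)\<^sup>2) *\<^sub>R g (paraboloid_graph y)
      \<partial>restrict_space lborel (ball 0 1))"
    by (intro integral_density measurable_restrict_lborel) auto
  also have "\<dots> = (LINT y:ball 0 1|lborel. sqrt (1 + (2 * norm y)\<^sup>2) *\<^sub>R g (paraboloid_graph y))"
    unfolding set_lebesgue_integral_def by (intro integral_restrict_space) auto
  finally show ?thesis .
qed

lemma nn_integral_vol_paraboloid:
  assumes g [measurable]: "g \<in> borel_measurable borel"
  shows "(\<integral>\<^sup>+\<omega>. g \<omega> \<partial>vol_paraboloid)
    = (\<integral>\<^sup>+y. ennreal (sqrt (1 + (2 * norm y)\<^sup>2)) * g (paraboloid_graph y) * indicator (ball 0 1) y \<partial>lborel)"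
proof -
  have "g \<in> borel_measurable (restrict_space borel paraboloid)"
    by (intro measurable_restrict_space1 g)
  then have "(\<integral>\<^sup>+\<omega>. g \<omega> \<partial>vol_paraboloid) = (\<integral>\<^sup>+y. g (paraboloid_graph y)
      \<partial>density (restrict_space lborel (ball 0 1)) (\<lambda>y. ennreal (sqrt (1 + (2 * norm y)\<^sup>2))))"
    unfolding vol_paraboloid_def
    by (intro nn_integral_distr measurable_paraboloid_graph_restrict) auto
  also have "\<dots> = (\<integral>\<^sup>+y. ennreal (sqrt (1 + (2 * norm y)\<^sup>2)) * g (paraboloid_graph y)
      \<partial>restrict_space lborel (ball 0 1))"
    by (intro nn_integral_density measurable_restrict_lborel) auto
  also have "\<dots> = (\<integral>\<^sup>+y. ennreal (sqrt (1 + (2 * norm y)\<^sup>2)) * g (paraboloid_graph y)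
        * indicator (ball 0 1) y \<partial>lborel)"
    by (intro nn_integral_restrict_space) auto
  finally show ?thesis .
qed

section \<open>Oscillatory integrals over planar regions\<close>

definition osc_integral :: "(real^2) set \<Rightarrow> real^3 \<Rightarrow> complex" where
  "osc_integral D x = (LINT y:D|lborel. cis (paraboloid_graph y \<bullet> x))"

lemma measurable_cis_phase [measurable]:
  "(\<lambda>y. cis (paraboloid_graph y \<bullet> x)) \<in> borel_measurable borel"
  unfolding cis_conv_exp by measurable

lemma set_integrable_cis_phase:
  assumes "D \<in> fmeasurable lborel"
  shows "set_integrable lborel D (\<lambda>y. cis (paraboloid_graph y \<bullet> x))"
proof -
  have [measurable]: "D \<in> sets borel" using assms by (auto simp: fmeasurable_def)
  have "emeasure lborel D < \<infinity>" using assms by (auto simp: fmeasurable_def)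
  then have "integrable lborel (indicator D :: _ \<Rightarrow> real)" by simp
  then show ?thesis unfolding set_integrable_def
    by (rule Bochner_Integration.integrable_bound) (auto simp: indicator_def)
qed

lemma measurable_osc_integral [measurable]:
  assumes [measurable]: "D \<in> sets borel"
  shows "osc_integral D \<in> borel_measurable borel"
  unfolding osc_integral_def set_lebesgue_integral_def cis_conv_exp by measurable

lemma norm_osc_integral_le:
  assumes "D \<in> fmeasurable lborel"
  shows "norm (osc_integral D x) \<le> measure lborel D"
proof -
  have "norm (osc_integral D x) \<le> (LINT y:D|lborel. norm (cis (paraboloid_graph y \<bullet> x)))"
    unfolding osc_integral_def by (intro set_integral_norm_bound set_integrable_cis_phase assms)
  also have "\<dots> = measure lborel D"
    using assms by (simp add: set_lebesgue_integral_def fmeasurable_def)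
  finally show ?thesis .
qed

text \<open>
No cancellation occurs when the phase stays within \<open>1/2\<close> of a constant \<open>\<theta>\<close>: after multiplication with
\<open>cis (- \<theta>)\<close> the integrand has real part at least \<open>cos (\<pi>/3) = 1/2\<close>.
\<close>

lemma norm_osc_integral_ge:
  assumes D: "D \<in> fmeasurable lborel"
    and \<theta>: "\<And>y. y \<in> D \<Longrightarrow> \<bar>paraboloid_graph y \<bullet> x - \<theta>\<bar> \<le> 1 / 2"
  shows "measure lborel D / 2 \<le> norm (osc_integral D x)"
proof -
  have [measurable]: "D \<in> sets borel" using D by (auto simp: fmeasurable_def)
  have int: "integrable lborel (\<lambda>y. indicator D y *\<^sub>R (cis (- \<theta>) * cis (paraboloid_graph y \<bullet> x)))"
    using set_integrable_mult_right[OF set_integrable_cis_phase[OF D]] by (simp add: set_integrable_def)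
  have eq: "cis (- \<theta>) * osc_integral D x
      = (\<integral>y. indicator D y *\<^sub>R (cis (- \<theta>) * cis (paraboloid_graph y \<bullet> x)) \<partial>lborel)"
    unfolding osc_integral_def by (simp flip: set_lebesgue_integral_def)
  have cos: "1 / 2 \<le> cos (paraboloid_graph y \<bullet> x - \<theta>)" if "y \<in> D" for y
  proof -
    have "cos (pi / 3) \<le> cos \<bar>paraboloid_graph y \<bullet> x - \<theta>\<bar>"
      using \<theta>[OF that] pi_gt3 by (intro cos_monotone_0_pi_le) auto
    then show ?thesis by (simp add: cos_60)
  qed
  have "measure lborel D / 2 = (\<integral>y. indicator D y *\<^sub>R (1 / 2 :: real) \<partial>lborel)"
    using D by (simp add: fmeasurable_def)
  also have "\<dots> \<le> (\<integral>y. Re (indicator D y *\<^sub>R (cis (- \<theta>) * cis (paraboloid_graph y \<bullet> x))) \<partial>lborel)"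
  proof (intro integral_mono)
    show "integrable lborel (\<lambda>y. indicator D y *\<^sub>R (1 / 2 :: real))"
      using D by (auto simp: fmeasurable_def)
    show "integrable lborel (\<lambda>y. Re (indicator D y *\<^sub>R (cis (- \<theta>) * cis (paraboloid_graph y \<bullet> x))))"
      using int by (rule integrable_Re)
    show "indicator D y *\<^sub>R (1 / 2 :: real)
        \<le> Re (indicator D y *\<^sub>R (cis (- \<theta>) * cis (paraboloid_graph y \<bullet> x)))" for y
      using cos[of y] by (auto simp: indicator_def cis_mult)
  qed
  also have "\<dots> = Re (cis (- \<theta>) * osc_integral D x)"
    unfolding eq using int by (rule integral_Re)
  also have "\<dots> \<le> norm (osc_integral D x)"
    by (metis complex_Re_le_cmod mult_1 norm_cis norm_mult)
  finally show ?thesis .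
qed

section \<open>Extension of a signed sum of cells\<close>

text \<open>
The denominator is the surface area element of the paraboloid.  It cancels in the extension operator,
which leaves a signed sum of oscillatory integrals with respect to Lebesgue measure in the plane.
\<close>

definition signed_cells :: "'i set \<Rightarrow> ('i \<Rightarrow> (real^2) set) \<Rightarrow> 'i set \<Rightarrow> real^3 \<Rightarrow> complex" where
  "signed_cells J Q S \<omega> = of_real (rademacher_sum J S (\<lambda>j. indicator (Q j) (horizontal \<omega>))
                              / sqrt (1 + (2 * norm (horizontal \<omega>))\<^sup>2))"

lemma measurable_signed_cells [measurable]:
  assumes [measurable]: "\<And>j. j \<in> J \<Longrightarrow> Q j \<in> sets borel"
  shows "signed_cells J Q S \<in> borel_measurable borel"
  unfolding signed_cells_def rademacher_sum_def by measurable

lemma ext_op_restrict_signed_cells: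
  assumes J: "finite J" and Q: "\<And>j. j \<in> J \<Longrightarrow> Q j \<in> sets borel" "\<And>j. j \<in> J \<Longrightarrow> Q j \<subseteq> ball 0 1"
    and \<tau> [measurable]: "\<tau> \<in> sets borel"
  shows "ext_op (restrict_to_cap \<tau> (signed_cells J Q S)) x
    = rademacher_sum J S (\<lambda>j. osc_integral (Q j \<inter> paraboloid_graph -` \<tau>) x)"
proof -
  note Q(1)[measurable]
  have "paraboloid_graph -` \<tau> \<inter> space borel \<in> sets borel"
    by (rule measurable_sets[OF measurable_paraboloid_graph \<tau>])
  then have pre: "paraboloid_graph -` \<tau> \<in> sets borel" by simp
  have fm: "Q j \<inter> paraboloid_graph -` \<tau> \<in> fmeasurable lborel" if "j \<in> J" for j
    by (rule fmeasurableI2[of "ball 0 1"]) (use Q that pre emeasure_lborel_ball_finite[of "0::real^2" 1] in \<open>auto simp: fmeasurable_def\<close>)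
  let ?e = "\<lambda>y. cis (paraboloid_graph y \<bullet> x)"
  have "(\<lambda>\<omega>. exp (\<i> * of_real (\<omega> \<bullet> x)) * restrict_to_cap \<tau> (signed_cells J Q S) \<omega>) \<in> borel_measurable borel"
    unfolding restrict_to_cap_def by measurable
  then have "ext_op (restrict_to_cap \<tau> (signed_cells J Q S)) x
    = (LINT y:ball 0 1|lborel. sqrt (1 + (2 * norm y)\<^sup>2) *\<^sub>R (exp (\<i> * of_real (paraboloid_graph y \<bullet> x))
         * restrict_to_cap \<tau> (signed_cells J Q S) (paraboloid_graph y)))"
    unfolding ext_op_def by (rule integral_vol_paraboloid)
  also have "\<dots> = (\<integral>y. rademacher_sum J S (\<lambda>j. indicator (Q j \<inter> paraboloid_graph -` \<tau>) y *\<^sub>R ?e y) \<partial>lborel)"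
    unfolding set_lebesgue_integral_def
  proof (rule Bochner_Integration.integral_cong[OF refl])
    fix y :: "real^2"
    define s where "s = sqrt (1 + (2 * norm y)\<^sup>2)"
    have "0 < 1 + (2 * norm y)\<^sup>2" by (rule add_pos_nonneg) auto
    then have s: "s \<noteq> 0" by (simp add: s_def)
    have "rademacher_sum J S (\<lambda>j. indicator (Q j) y) * indicator \<tau> (paraboloid_graph y) * indicator (ball 0 1) y
        = rademacher_sum J S (\<lambda>j. indicator (Q j \<inter> paraboloid_graph -` \<tau>) y :: real)"
      unfolding rademacher_sum_def sum_distrib_right
      using subsetD[OF Q(2)] by (intro sum.cong) (auto simp: indicator_def)
    moreover have "rademacher_sum J S (\<lambda>j. indicator (Q j \<inter> paraboloid_graph -` \<tau>) y *\<^sub>R ?e y)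
        = rademacher_sum J S (\<lambda>j. indicator (Q j \<inter> paraboloid_graph -` \<tau>) y) *\<^sub>R ?e y"
      by (simp add: rademacher_sum_def scaleR_sum_left)
    ultimately show "indicator (ball 0 1) y *\<^sub>R sqrt (1 + (2 * norm y)\<^sup>2) *\<^sub>R (exp (\<i> * of_real (paraboloid_graph y \<bullet> x))
         * restrict_to_cap \<tau> (signed_cells J Q S) (paraboloid_graph y))
      = rademacher_sum J S (\<lambda>j. indicator (Q j \<inter> paraboloid_graph -` \<tau>) y *\<^sub>R ?e y)"
      unfolding restrict_to_cap_def signed_cells_def horizontal_paraboloid_graph s_def[symmetric] cis_conv_exp
      using s by (auto simp: scaleR_conv_of_real indicator_def split: if_splits)
  qed
  also have "\<dots> = rademacher_sum J S (\<lambda>j. \<integral>y. indicator (Q j \<inter> paraboloid_graph -` \<tau>) y *\<^sub>R ?e y \<partial>lborel)"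
  proof -
    have int: "integrable lborel (\<lambda>y. indicator (Q j \<inter> paraboloid_graph -` \<tau>) y *\<^sub>R ?e y)" if "j \<in> J" for j
      using set_integrable_cis_phase[OF fm[OF that]] by (simp add: set_integrable_def)
    show ?thesis
      unfolding rademacher_sum_def
      by (subst Bochner_Integration.integral_sum)
         (intro integrable_scaleR_right int sum.cong refl integral_scaleR_right; assumption)+
  qed
  also have "\<dots> = rademacher_sum J S (\<lambda>j. osc_integral (Q j \<inter> paraboloid_graph -` \<tau>) x)"
    by (simp add: osc_integral_def set_lebesgue_integral_def)
  finally show ?thesis .
qed

corollary ext_op_signed_cells:
  assumes J: "finite J" and Q: "\<And>j. j \<in> J \<Longrightarrow> Q j \<in> sets borel" "\<And>j. j \<in> J \<Longrightarrow> Q j \<subseteq> ball 0 1"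
  shows "ext_op (signed_cells J Q S) x = rademacher_sum J S (\<lambda>j. osc_integral (Q j) x)"
  using ext_op_restrict_signed_cells[OF assms, where \<tau> = UNIV and S = S and x = x] by (simp add: restrict_to_cap_def)

section \<open>A strip of cells and the slab on which their phases are frozen\<close>

text \<open>
Open boxes make the cells disjoint; the lines between them are null sets.
\<close>

definition cell :: "nat \<Rightarrow> nat \<Rightarrow> (real^2) set" where
  "cell M j = box (vector [real j / (2 * real M ^ 2), 0])
                  (vector [(real j + 1) / (2 * real M ^ 2), 1 / (2 * real M)])"

text \<open>
The side lengths are dual to the extent of a single cell, on which the phase must not vary:
\<open>x\<^sub>1\<close> and \<open>x\<^sub>3\<close> are paired with a change of size \<open>M\<^sup>-\<^sup>2\<close> in \<open>y\<^sub>1\<close> and \<open>|y|\<^sup>2\<close>, and \<open>x\<^sub>2\<close> with one of size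
\<open>M\<^sup>-\<^sup>1\<close> in \<open>y\<^sub>2\<close>.  The factor \<open>1/4\<close> keeps the total phase change below \<open>1/2\<close>.
\<close>

definition slab :: "nat \<Rightarrow> (real^3) set" where
  "slab M = cbox 0 (vector [real M ^ 2 / 4, real M / 4, real M ^ 2 / 4])"

lemma mem_cell:
  "y \<in> cell M j \<longleftrightarrow> real j / (2 * real M ^ 2) < y$1 \<and> y$1 < (real j + 1) / (2 * real M ^ 2)
      \<and> 0 < y$2 \<and> y$2 < 1 / (2 * real M)"
  by (auto simp: cell_def mem_box_cart forall_2)

lemma mem_slab:
  "x \<in> slab M \<longleftrightarrow> 0 \<le> x$1 \<and> x$1 \<le> real M ^ 2 / 4 \<and> 0 \<le> x$2 \<and> x$2 \<le> real M / 4
      \<and> 0 \<le> x$3 \<and> x$3 \<le> real M ^ 2 / 4"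
  by (auto simp: slab_def mem_box_cart forall_3)

lemma measure_lborel_cbox_2:
  fixes a b :: "real^2"
  assumes "a$1 \<le> b$1" "a$2 \<le> b$2"
  shows "measure lborel (cbox a b) = (b$1 - a$1) * (b$2 - a$2)"
proof -
  have "cbox a b \<noteq> {}"
    using assms by (auto simp: interval_ne_empty_cart forall_2)
  then show ?thesis
    by (simp add: content_cbox_cart UNIV_2)
qed

lemma measure_lborel_cbox_3:
  fixes a b :: "real^3"
  assumes "a$1 \<le> b$1" "a$2 \<le> b$2" "a$3 \<le> b$3"
  shows "measure lborel (cbox a b) = (b$1 - a$1) * (b$2 - a$2) * (b$3 - a$3)"
proof -
  have ne: "cbox a b \<noteq> {}"
    using assms by (auto simp: interval_ne_empty_cart forall_3)
  have prod_3: "prod f UNIV = f 1 * f 2 * f 3" for f :: "3 \<Rightarrow> real"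
    unfolding UNIV_3 by (simp add: ac_simps)
  show ?thesis
    unfolding content_cbox_cart[OF ne] by (rule prod_3)
qed

lemma cell_borel [measurable]: "cell M j \<in> sets borel"
  by (simp add: cell_def)

lemma cell_fmeasurable: "cell M j \<in> fmeasurable lborel"
  by (simp add: cell_def)

lemma measure_cell:
  assumes "M > 0"
  shows "measure lborel (cell M j) = 1 / (4 * real M ^ 3)"
proof -
  let ?l = "vector [real j / (2 * real M ^ 2), 0] :: real^2"
  let ?u = "vector [(real j + 1) / (2 * real M ^ 2), 1 / (2 * real M)] :: real^2"
  have "measure lborel (cell M j) = measure lborel (cbox ?l ?u)"
    unfolding cell_def measure_lborel_box_eq measure_lborel_cbox_eq ..
  also have "\<dots> = (?u$1 - ?l$1) * (?u$2 - ?l$2)"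
    by (rule measure_lborel_cbox_2) (auto simp: divide_right_mono)
  also have "\<dots> = 1 / (4 * real M ^ 3)"
    using assms by (simp add: field_simps power2_eq_square power3_eq_cube)
  finally show ?thesis .
qed

lemma cell_upper:
  assumes "M > 0" "j < M\<^sup>2"
  shows "(real j + 1) / (2 * real M ^ 2) \<le> 1 / 2"
proof -
  have "real j + 1 \<le> real M ^ 2"
    using assms(2) by (metis Suc_leI of_nat_Suc of_nat_le_iff of_nat_power add.commute)
  then show ?thesis using assms(1) by (simp add: field_simps)
qed

lemma cell_subset_ball:
  assumes "M > 0" "j < M\<^sup>2"
  shows "cell M j \<subseteq> ball 0 1"
proof
  fix y assume y: "y \<in> cell M j"
  have "1 / (2 * real M) \<le> 1 / 2" using assms(1) by (simp add: field_simps)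
  moreover have "0 \<le> real j / (2 * real M ^ 2)" by simp
  ultimately have "\<bar>y$1\<bar> + \<bar>y$2\<bar> < 1"
    using y cell_upper[OF assms] unfolding mem_cell by linarith
  then show "y \<in> ball 0 1"
    using norm_le_l1_cart[of y] by (simp add: sum_2)
qed

lemma disjoint_cells: "disjoint_family (cell M)"
proof (cases "M = 0")
  case True
  then show ?thesis by (auto simp: disjoint_family_on_def mem_cell)
next
  case False
  have "i = j" if "y \<in> cell M i" "y \<in> cell M j" for y i j
  proof -
    let ?t = "y$1 * (2 * real M ^ 2)"
    have "real i < ?t" "?t < real i + 1" "real j < ?t" "?t < real j + 1"
      using that False by (auto simp: mem_cell field_simps)
    then have "real i < real j + 1" "real j < real i + 1" by linarith+
    then show "i = j" by linarith
  qed
  then show ?thesis by (auto simp: disjoint_family_on_def)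
qed

lemma inner_paraboloid_graph:
  "paraboloid_graph y \<bullet> x = y$1 * x$1 + y$2 * x$2 + ((y$1)\<^sup>2 + (y$2)\<^sup>2) * x$3"
  by (simp add: inner_vec_def sum_3 paraboloid_graph_def)

text \<open>
The reference phase is the one at the left end \<open>(t, 0)\<close> of the cell.  The difference splits into four
nonnegative terms of size at most \<open>1/8\<close>, \<open>1/8\<close>, \<open>1/8\<close> and \<open>1/16\<close>.
\<close>

lemma phase_almost_constant:
  assumes M: "M > 0" and j: "j < M\<^sup>2" and y: "y \<in> cell M j" and x: "x \<in> slab M"
  defines "t \<equiv> real j / (2 * real M ^ 2)"
  shows "\<bar>paraboloid_graph y \<bullet> x - (t * x$1 + t\<^sup>2 * x$3)\<bar> \<le> 1 / 2"
proof -
  have t: "0 \<le> t" "t \<le> y$1" by (use y in \<open>auto simp: t_def mem_cell\<close>)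
  have y1: "y$1 \<le> 1 / 2" using cell_upper[OF M j] y unfolding mem_cell by linarith
  have d: "y$1 - t \<le> 1 / (2 * real M ^ 2)"
    using y by (auto simp: mem_cell t_def add_divide_distrib)
  have y2: "0 \<le> y$2" "y$2 \<le> 1 / (2 * real M)" using y by (auto simp: mem_cell)
  note x = x[unfolded mem_slab]
  have "(y$1 - t) * x$1 \<le> 1 / (2 * real M ^ 2) * (real M ^ 2 / 4)"
    using d x t by (intro mult_mono) auto
  moreover have "y$2 * x$2 \<le> 1 / (2 * real M) * (real M / 4)"
    using y2 x by (intro mult_mono) auto
  moreover have "(y$1 - t) * (y$1 + t) * x$3 \<le> 1 / (2 * real M ^ 2) * 1 * (real M ^ 2 / 4)"
    using d x t y1 by (intro mult_mono) auto
  moreover have "(y$2)\<^sup>2 * x$3 \<le> (1 / (2 * real M))\<^sup>2 * (real M ^ 2 / 4)"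
    using y2 x by (intro mult_mono power_mono) auto
  moreover have "0 \<le> (y$1 - t) * x$1" "0 \<le> y$2 * x$2" "0 \<le> (y$1 - t) * (y$1 + t) * x$3"
    "0 \<le> (y$2)\<^sup>2 * x$3"
    using t y2 x by auto
  moreover have "paraboloid_graph y \<bullet> x - (t * x$1 + t\<^sup>2 * x$3)
      = (y$1 - t) * x$1 + y$2 * x$2 + (y$1 - t) * (y$1 + t) * x$3 + (y$2)\<^sup>2 * x$3"
    by (simp add: inner_paraboloid_graph power2_eq_square algebra_simps)
  ultimately show ?thesis
    using M by (simp add: power_divide power_mult_distrib)
qed

text \<open>
Each of the \<open>M\<^sup>2\<close> cells has area \<open>1 / (4 M\<^sup>3)\<close> and contributes at least half of it.
\<close>

lemma energy_ge:
  assumes M: "M > 0" and x: "x \<in> slab M"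
  shows "1 / (64 * real M ^ 4) \<le> (\<Sum>j<M\<^sup>2. (norm (osc_integral (cell M j) x))\<^sup>2)"
proof -
  have "(1 / (8 * real M ^ 3))\<^sup>2 \<le> (norm (osc_integral (cell M j) x))\<^sup>2" if "j < M\<^sup>2" for j
  proof (intro power_mono)
    have "measure lborel (cell M j) / 2 \<le> norm (osc_integral (cell M j) x)"
      by (rule norm_osc_integral_ge[OF cell_fmeasurable phase_almost_constant[OF M that _ x]])
    then show "1 / (8 * real M ^ 3) \<le> norm (osc_integral (cell M j) x)"
      by (simp add: measure_cell[OF M])
  qed simp
  then have "(\<Sum>j<M\<^sup>2. (1 / (8 * real M ^ 3))\<^sup>2) \<le> (\<Sum>j<M\<^sup>2. (norm (osc_integral (cell M j) x))\<^sup>2)"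
    by (intro sum_mono) auto
  moreover have "(\<Sum>j<M\<^sup>2. (1 / (8 * real M ^ 3))\<^sup>2) = 1 / (64 * real M ^ 4)"
    using M by (simp add: field_simps power2_eq_square power3_eq_cube power4_eq_xxxx)
  ultimately show ?thesis by simp
qed

lemma vimage_paraboloid_graph_borel:
  assumes "\<tau> \<in> sets borel"
  shows "paraboloid_graph -` \<tau> \<in> sets borel"
  using measurable_sets[OF measurable_paraboloid_graph assms] by simp

lemma cell_inter_cap_fmeasurable:
  "\<tau> \<in> sets borel \<Longrightarrow> cell M j \<inter> paraboloid_graph -` \<tau> \<in> fmeasurable lborel"
  using cell_fmeasurable by (rule fmeasurable_Int_fmeasurable) (simp add: vimage_paraboloid_graph_borel)

text \<open>
The part of the strip below a cap lies in a rectangle of length \<open>2 A / k\<close> and the width \<open>1 / (2 M)\<close> of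
the strip.
\<close>

lemma measure_cells_inter_cap_le:
  assumes M: "M > 0" and k: "k > 0" and A: "A > 0" and \<tau>: "is_cap a A k \<tau>"
  shows "(\<Sum>j<M\<^sup>2. measure lborel (cell M j \<inter> paraboloid_graph -` \<tau>)) \<le> A / (k * M)"
proof -
  obtain D w where D: "\<tau> = paraboloid_graph ` D" "D \<subseteq> ball w (A / k)"
    and \<tau>b: "\<tau> \<in> sets borel"
    using \<tau> by (auto simp: is_cap_def)
  let ?l = "vector [w$1 - A / k, 0] :: real^2"
  let ?u = "vector [w$1 + A / k, 1 / (2 * real M)] :: real^2"
  have "disjoint_family_on (\<lambda>j. cell M j \<inter> paraboloid_graph -` \<tau>) {..<M\<^sup>2}"
    using disjoint_cells[of M] unfolding disjoint_family_on_def by blast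
  then have "(\<Sum>j<M\<^sup>2. measure lborel (cell M j \<inter> paraboloid_graph -` \<tau>))
      = measure lborel (\<Union>j<M\<^sup>2. cell M j \<inter> paraboloid_graph -` \<tau>)"
    using cell_inter_cap_fmeasurable[OF \<tau>b]
    by (intro measure_finite_Union[symmetric])
       (auto simp: fmeasurable_def image_subset_iff less_top[symmetric])
  also have "\<dots> \<le> measure lborel (cbox ?l ?u)"
  proof (rule measure_mono_fmeasurable)
    show "(\<Union>j<M\<^sup>2. cell M j \<inter> paraboloid_graph -` \<tau>) \<subseteq> cbox ?l ?u"
    proof clarify
      fix y j assume y: "y \<in> cell M j" and "paraboloid_graph y \<in> \<tau>"
      then have "y \<in> D" using D(1) inj_paraboloid_graph by (auto dest: injD)
      then have "norm (w - y) < A / k" using D(2) by (auto simp: dist_norm)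
      then have "\<bar>w$1 - y$1\<bar> < A / k"
        using component_le_norm_cart[of "w - y" 1] by simp
      then show "y \<in> cbox ?l ?u"
        using y by (auto simp: mem_box_cart forall_2 mem_cell)
    qed
    show "(\<Union>j<M\<^sup>2. cell M j \<inter> paraboloid_graph -` \<tau>) \<in> sets lborel"
      using vimage_paraboloid_graph_borel[OF \<tau>b] by (intro sets.finite_UN) auto
  qed auto
  also have "\<dots> = A / (k * M)"
    using A k by (subst measure_lborel_cbox_2) (auto simp: field_simps)
  finally show ?thesis .
qed

text \<open>
The sum of the squared energies \<open>w \<tau>\<close> is at most their maximum times their sum.  Since each
coefficient is at most the area \<open>v\<close> of a cell, \<open>w \<tau>\<close> is at most \<open>v\<close> times the area of the strip below \<open>\<tau>\<close>,
which gains the factor \<open>1/k\<close>; and since the caps are disjoint, these areas add up to at most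
the area of the strip.
\<close>

lemma cap_energies_le:
  fixes x :: "real^3"
  assumes M: "M > 0" and k: "k > 0" and A: "A > 0" and T: "is_cap_partition a A k T"
    and T': "finite T'" "T' \<subseteq> T"
  defines "w \<equiv> \<lambda>\<tau>. \<Sum>j<M\<^sup>2. (norm (osc_integral (cell M j \<inter> paraboloid_graph -` \<tau>) x))\<^sup>2"
  shows "(\<Sum>\<tau>\<in>T'. (w \<tau>)\<^sup>2) \<le> A / (64 * k * real M ^ 8)"
proof -
  define v where "v = 1 / (4 * real M ^ 3)"
  define \<mu> where "\<mu> \<tau> j = measure lborel (cell M j \<inter> paraboloid_graph -` \<tau>)" for \<tau> j
  have v: "measure lborel (cell M j) = v" for j by (simp add: v_def measure_cell[OF M])
  have v0: "v \<ge> 0" by (simp add: v_def)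
  have cap: "is_cap a A k \<tau>" "\<tau> \<in> sets borel" if "\<tau> \<in> T'" for \<tau>
    using T T'(2) that by (auto simp: is_cap_partition_def is_cap_def)
  have disj: "\<sigma> \<inter> \<tau> = {}" if "\<sigma> \<in> T'" "\<tau> \<in> T'" "\<sigma> \<noteq> \<tau>" for \<sigma> \<tau>
    using T T'(2) that unfolding is_cap_partition_def partition_on_def disjoint_def by blast
  have w_le: "w \<tau> \<le> v * (\<Sum>j<M\<^sup>2. \<mu> \<tau> j)" if "\<tau> \<in> T'" for \<tau>
    unfolding w_def sum_distrib_left
  proof (rule sum_mono)
    fix j
    have "norm (osc_integral (cell M j \<inter> paraboloid_graph -` \<tau>) x) \<le> \<mu> \<tau> j"
      unfolding \<mu>_def by (intro norm_osc_integral_le cell_inter_cap_fmeasurable cap that)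
    moreover have "\<mu> \<tau> j \<le> v"
      unfolding \<mu>_def v[of j, symmetric] using fmeasurableD[OF cell_inter_cap_fmeasurable[OF cap(2)[OF that]]]
      by (intro measure_mono_fmeasurable cell_fmeasurable) auto
    ultimately show "(norm (osc_integral (cell M j \<inter> paraboloid_graph -` \<tau>) x))\<^sup>2 \<le> v * \<mu> \<tau> j"
      unfolding power2_eq_square using v0 by (intro mult_mono) auto
  qed
  have w0: "0 \<le> w \<tau>" for \<tau> unfolding w_def by (intro sum_nonneg) auto
  have "(\<Sum>\<tau>\<in>T'. \<mu> \<tau> j) \<le> v" for j
  proof -
    have "disjoint_family_on (\<lambda>\<tau>. cell M j \<inter> paraboloid_graph -` \<tau>) T'"
      using disj unfolding disjoint_family_on_def by blast
    then have "(\<Sum>\<tau>\<in>T'. \<mu> \<tau> j) = measure lborel (\<Union>\<tau>\<in>T'. cell M j \<inter> paraboloid_graph -` \<tau>)"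
      unfolding \<mu>_def
      using T'(1) fmeasurableD[OF cell_inter_cap_fmeasurable[OF cap(2)]]
        fmeasurableD2[OF cell_inter_cap_fmeasurable[OF cap(2)]]
      by (intro measure_finite_Union[symmetric]) auto
    also have "\<dots> \<le> v"
      unfolding v[of j, symmetric] using vimage_paraboloid_graph_borel[OF cap(2)] T'(1)
      by (intro measure_mono_fmeasurable cell_fmeasurable sets.finite_UN) auto
    finally show ?thesis .
  qed
  then have "(\<Sum>j<M\<^sup>2. \<Sum>\<tau>\<in>T'. \<mu> \<tau> j) \<le> (\<Sum>j<M\<^sup>2. v)"
    by (intro sum_mono) auto
  then have total: "(\<Sum>\<tau>\<in>T'. \<Sum>j<M\<^sup>2. \<mu> \<tau> j) \<le> real M ^ 2 * v"
    by (subst sum.swap) simp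
  have "(\<Sum>\<tau>\<in>T'. (w \<tau>)\<^sup>2) \<le> (\<Sum>\<tau>\<in>T'. (v * (A / (k * M))) * (v * (\<Sum>j<M\<^sup>2. \<mu> \<tau> j)))"
  proof (rule sum_mono)
    fix \<tau> assume \<tau>: "\<tau> \<in> T'"
    have "(\<Sum>j<M\<^sup>2. \<mu> \<tau> j) \<le> A / (k * M)"
      unfolding \<mu>_def by (rule measure_cells_inter_cap_le[OF M k A cap(1)[OF \<tau>]])
    then have "w \<tau> \<le> v * (A / (k * M))"
      using w_le[OF \<tau>] v0 by (meson mult_left_mono order_trans)
    then have "w \<tau> * w \<tau> \<le> (v * (A / (k * M))) * (v * (\<Sum>j<M\<^sup>2. \<mu> \<tau> j))"
      using w_le[OF \<tau>] w0 v0 A k by (intro mult_mono) auto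
    then show "(w \<tau>)\<^sup>2 \<le> (v * (A / (k * M))) * (v * (\<Sum>j<M\<^sup>2. \<mu> \<tau> j))"
      by (simp only: power2_eq_square[of "w \<tau>"])
  qed
  also have "\<dots> = (v * (A / (k * M))) * v * (\<Sum>\<tau>\<in>T'. \<Sum>j<M\<^sup>2. \<mu> \<tau> j)"
    by (simp add: sum_distrib_left mult.assoc)
  also have "\<dots> \<le> (v * (A / (k * M))) * v * (real M ^ 2 * v)"
    using v0 A k by (intro mult_left_mono total) auto
  also have "\<dots> = A / (64 * k * real M ^ 8)"
    using M k by (simp add: v_def eval_nat_numeral)
  finally show ?thesis .
qed

section \<open>The broad part for random signs\<close>

abbreviation signed_strip :: "nat \<Rightarrow> nat set \<Rightarrow> real^3 \<Rightarrow> complex" where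
  "signed_strip M \<equiv> signed_cells {..<M\<^sup>2} (cell M)"

text \<open>
Needed for the measurability of the broad part.  The planar regions of the caps have nonempty, pairwise disjoint
interiors, and the plane is second countable.
\<close>

lemma cap_partition_countable:
  assumes T: "is_cap_partition a A k T" and "a > 0" "k > 0"
  shows "countable T"
proof -
  let ?U = "\<lambda>\<tau>. interior (paraboloid_graph -` \<tau>)"
  have ne: "?U \<tau> \<noteq> {}" if "\<tau> \<in> T" for \<tau>
  proof -
    have "is_cap a A k \<tau>" using T \<open>\<tau> \<in> T\<close> by (simp add: is_cap_partition_def)
    then obtain D w where "\<tau> = paraboloid_graph ` D" "ball w (a / k) \<subseteq> D"
      unfolding is_cap_def by metis
    then have "ball w (a / k) \<subseteq> paraboloid_graph -` \<tau>" by blast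
    then have "ball w (a / k) \<subseteq> ?U \<tau>" by (simp add: interior_maximal)
    moreover have "w \<in> ball w (a / k)" using assms(2,3) by simp
    ultimately show ?thesis by blast
  qed
  have disj: "?U \<sigma> \<inter> ?U \<tau> = {}" if "\<sigma> \<in> T" "\<tau> \<in> T" "\<sigma> \<noteq> \<tau>" for \<sigma> \<tau>
  proof -
    have "\<sigma> \<inter> \<tau> = {}"
      using T that unfolding is_cap_partition_def partition_on_def disjoint_def by blast
    then have "paraboloid_graph -` \<sigma> \<inter> paraboloid_graph -` \<tau> = {}" by blast
    then show ?thesis by (metis interior_Int interior_empty)
  qed
  have "countable (?U ` T)"
  proof (rule countable_disjoint_open_subsets)
    show "pairwise disjnt (?U ` T)"
      unfolding pairwise_image pairwise_def disjnt_def using disj by blast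
  qed auto
  moreover have "inj_on ?U T"
    using disj ne by (metis (no_types, lifting) inf.idem inj_onI)
  ultimately show ?thesis by (rule countable_image_inj_on)
qed

lemma ext_op_signed_strip:
  assumes "M > 0"
  shows "ext_op (signed_strip M S) x = rademacher_sum {..<M\<^sup>2} S (\<lambda>j. osc_integral (cell M j) x)"
    and "\<tau> \<in> sets borel \<Longrightarrow> ext_op (restrict_to_cap \<tau> (signed_strip M S)) x
           = rademacher_sum {..<M\<^sup>2} S (\<lambda>j. osc_integral (cell M j \<inter> paraboloid_graph -` \<tau>) x)"
  using cell_subset_ball[OF assms]
  by (auto intro!: ext_op_signed_cells ext_op_restrict_signed_cells)

lemma measurable_ext_op_signed_strip:
  assumes "M > 0" "\<tau> \<in> sets borel"
  shows "ext_op (signed_strip M S) \<in> borel_measurable borel"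
    and "ext_op (restrict_to_cap \<tau> (signed_strip M S)) \<in> borel_measurable borel"
proof -
  note [measurable] = vimage_paraboloid_graph_borel[OF assms(2)]
  show "ext_op (signed_strip M S) \<in> borel_measurable borel"
    unfolding ext_op_signed_strip(1)[OF assms(1), abs_def] rademacher_sum_def by measurable
  have "ext_op (restrict_to_cap \<tau> (signed_strip M S)) = (\<lambda>x. rademacher_sum {..<M\<^sup>2} S (\<lambda>j. osc_integral (cell M j \<inter> paraboloid_graph -` \<tau>) x))"
    by (intro ext ext_op_signed_strip(2) assms)
  then show "ext_op (restrict_to_cap \<tau> (signed_strip M S)) \<in> borel_measurable borel"
    unfolding rademacher_sum_def by simp
qed

lemma measurable_broad_part:
  assumes M: "M > 0" and T: "is_cap_partition a A k T" and a: "a > 0" and k: "k > 0"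
  shows "broad_part T k \<epsilon> (signed_strip M S) \<in> borel_measurable borel"
proof -
  have [measurable]: "ext_op (signed_strip M S) \<in> borel_measurable borel"
    by (rule measurable_ext_op_signed_strip[OF M sets.empty_sets])
  have "Measurable.pred borel (\<lambda>x. \<forall>\<tau>\<in>T. norm (ext_op (restrict_to_cap \<tau> (signed_strip M S)) x)
            \<le> k powr (-\<epsilon>) * norm (ext_op (signed_strip M S) x))"
  proof (rule measurable_pred_countable(1))
    show "countable T" by (rule cap_partition_countable[OF T a k])
    fix \<tau> assume "\<tau> \<in> T"
    then have "\<tau> \<in> sets borel" using T by (auto simp: is_cap_partition_def is_cap_def)
    show "Measurable.pred borel (\<lambda>x. norm (ext_op (restrict_to_cap \<tau> (signed_strip M S)) x)
            \<le> k powr (-\<epsilon>) * norm (ext_op (signed_strip M S) x))"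
      unfolding pred_def
      by (intro borel_measurable_le borel_measurable_times borel_measurable_const
            measurable_compose[OF _ borel_measurable_norm] measurable_ext_op_signed_strip[OF M \<open>\<tau> \<in> sets borel\<close>])
  qed
  then show ?thesis
    unfolding broad_part_def[abs_def] is_broad_def by measurable
qed

text \<open>
The hypothesis \<open>large\<close> is what makes the cap energies, which are \<open>O(1/k)\<close>, small against the loss \<open>k\<^sup>4\<^sup>\<epsilon>\<close>
of the broadness condition.
\<close>

lemma broad_part_second_moment:
  assumes M: "M > 0" and k: "k > 0" and A: "A > 0" and T: "is_cap_partition a A k T"
    and large: "768 * A * k powr (4 * \<epsilon>) \<le> k" and x: "x \<in> slab M"
  shows "2 ^ (M\<^sup>2) / (128 * real M ^ 4)
    \<le> (\<Sum>S\<in>Pow {..<M\<^sup>2}. (broad_part T k \<epsilon> (signed_strip M S) x)\<^sup>2)"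
proof -
  define b where "b j = osc_integral (cell M j) x" for j
  define c where "c \<tau> j = osc_integral (cell M j \<inter> paraboloid_graph -` \<tau>) x" for \<tau> j
  let ?W = "\<Sum>j<M\<^sup>2. (norm (b j))\<^sup>2"
  have W: "1 / (64 * real M ^ 4) \<le> ?W"
    unfolding b_def by (rule energy_ge[OF M x])
  have Tb: "\<tau> \<in> sets borel" if "\<tau> \<in> T" for \<tau>
    using T that by (auto simp: is_cap_partition_def is_cap_def)
  have small: "12 * (\<Sum>\<tau>\<in>T'. (\<Sum>j<M\<^sup>2. (norm (c \<tau> j))\<^sup>2)\<^sup>2) \<le> (k powr (-\<epsilon>)) ^ 4 * ?W\<^sup>2"
    if T': "finite T'" "T' \<subseteq> T" for T'
  proof -
    have "12 * (\<Sum>\<tau>\<in>T'. (\<Sum>j<M\<^sup>2. (norm (c \<tau> j))\<^sup>2)\<^sup>2) \<le> 12 * (A / (64 * k * real M ^ 8))"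
      unfolding c_def by (intro mult_left_mono cap_energies_le[OF M k A T T']) auto
    also have "\<dots> \<le> k powr (-(4 * \<epsilon>)) * (1 / (64 * real M ^ 4))\<^sup>2"
      using large k M by (simp add: powr_minus field_simps power2_eq_square flip: power_add)
    also have "k powr (-(4 * \<epsilon>)) = (k powr (-\<epsilon>)) ^ 4"
      using k by (simp add: powr_power mult.commute)
    also have "(k powr (-\<epsilon>)) ^ 4 * (1 / (64 * real M ^ 4))\<^sup>2 \<le> (k powr (-\<epsilon>)) ^ 4 * ?W\<^sup>2"
      by (intro mult_left_mono power_mono W) auto
    finally show ?thesis .
  qed
  have "2 ^ (M\<^sup>2) / (128 * real M ^ 4) = 2 ^ card {..<M\<^sup>2} * (1 / (64 * real M ^ 4)) / 2"
    by simp
  also have "\<dots> \<le> 2 ^ card {..<M\<^sup>2} * ?W / 2"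
    by (intro divide_right_mono mult_left_mono W) auto
  also have "\<dots> \<le> (\<Sum>S\<in>Pow {..<M\<^sup>2}.
      (if \<forall>\<tau>\<in>T. norm (rademacher_sum {..<M\<^sup>2} S (c \<tau>)) \<le> k powr (-\<epsilon>) * norm (rademacher_sum {..<M\<^sup>2} S b)
       then norm (rademacher_sum {..<M\<^sup>2} S b) else 0)\<^sup>2)"
    by (rule broad_second_moment[OF _ _ small]) (use k in auto)
  also have "\<dots> = (\<Sum>S\<in>Pow {..<M\<^sup>2}. (broad_part T k \<epsilon> (signed_strip M S) x)\<^sup>2)"
    unfolding broad_part_def is_broad_def ext_op_signed_strip(1)[OF M] b_def[abs_def] c_def[abs_def]
    using Tb by (simp add: ext_op_signed_strip(2)[OF M] cong: ball_cong)
  finally show ?thesis .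
qed

text \<open>
The level \<open>l = 1 / (16 M\<^sup>2)\<close> is chosen so that the mean of the square of the broad part is at least
\<open>2 l\<^sup>2\<close>; then the bound \<open>u\<^bsup>p/2\<^esup> \<ge> u - 1\<close> leaves a mean of at least \<open>1\<close> after division by \<open>l\<^sup>p\<close>.
\<close>

lemma broad_part_pth_moment:
  assumes M: "M > 0" and k: "k > 0" and A: "A > 0" and T: "is_cap_partition a A k T"
    and large: "768 * A * k powr (4 * \<epsilon>) \<le> k" and x: "x \<in> slab M" and p: "2 \<le> p"
  shows "2 ^ (M\<^sup>2) * (1 / (16 * real M ^ 2)) powr p
    \<le> (\<Sum>S\<in>Pow {..<M\<^sup>2}. norm (broad_part T k \<epsilon> (signed_strip M S) x) powr p)"
proof -
  define l where "l = 1 / (16 * real M ^ 2)"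
  have l: "l > 0" using M by (simp add: l_def)
  let ?br = "\<lambda>S. broad_part T k \<epsilon> (signed_strip M S) x"
  have "2 * 2 ^ (M\<^sup>2) = (2 ^ (M\<^sup>2) / (128 * real M ^ 4)) / l\<^sup>2"
    using M by (simp add: l_def field_simps eval_nat_numeral)
  also have "\<dots> \<le> (\<Sum>S\<in>Pow {..<M\<^sup>2}. (?br S)\<^sup>2) / l\<^sup>2"
    by (intro divide_right_mono broad_part_second_moment[OF M k A T large x]) auto
  finally have "2 ^ (M\<^sup>2) \<le> (\<Sum>S\<in>Pow {..<M\<^sup>2}. (?br S)\<^sup>2 / l\<^sup>2 - 1)"
    by (simp add: sum_subtractf card_Pow sum_divide_distrib)
  then have "2 ^ (M\<^sup>2) * l powr p \<le> l powr p * (\<Sum>S\<in>Pow {..<M\<^sup>2}. (?br S)\<^sup>2 / l\<^sup>2 - 1)"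
    by (simp add: mult.commute mult_left_mono)
  also have "\<dots> = (\<Sum>S\<in>Pow {..<M\<^sup>2}. l powr p * ((norm (?br S))\<^sup>2 / l\<^sup>2 - 1))"
    by (simp add: sum_distrib_left)
  also have "\<dots> \<le> (\<Sum>S\<in>Pow {..<M\<^sup>2}. norm (?br S) powr p)"
    using l p by (intro sum_mono powr_ge_quadratic) auto
  finally show ?thesis by (simp add: l_def)
qed

lemma emeasure_slab: "emeasure lborel (slab M) = ennreal (real M ^ 5 / 64)"
proof -
  have "measure lborel (slab M) = (real M ^ 2 / 4) * (real M / 4) * (real M ^ 2 / 4)"
    unfolding slab_def by (subst measure_lborel_cbox_3) auto
  also have "\<dots> = real M ^ 5 / 64"
    by (simp add: eval_nat_numeral)
  finally have "measure lborel (slab M) = real M ^ 5 / 64" .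
  moreover have "slab M \<in> fmeasurable lborel"
    by (simp add: slab_def)
  ultimately show ?thesis
    by (metis emeasure_eq_ennreal_measure fmeasurableD2 infinity_ennreal_def)
qed

lemma slab_subset_ball:
  assumes "M > 0"
  shows "slab M \<subseteq> ball 0 (real M ^ 2)"
proof
  fix x assume x: "x \<in> slab M"
  have "real M \<le> real M ^ 2" using assms by (simp add: self_le_power)
  moreover have "0 < real M" using assms by simp
  ultimately have "\<bar>x$1\<bar> + \<bar>x$2\<bar> + \<bar>x$3\<bar> < real M ^ 2"
    using x unfolding mem_slab by linarith
  then show "x \<in> ball 0 (real M ^ 2)"
    using norm_le_l1_cart[of x] by (simp add: sum_3)
qed

text \<open>
Integrate the moment bound over the slab and exchange the integral with the sum over signs; the best
choice of signs does at least as well as the average.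
\<close>

lemma exists_signs_broad_large:
  assumes M: "M > 0" and k: "k > 0" and a: "a > 0" and A: "A > 0" and T: "is_cap_partition a A k T"
    and large: "768 * A * k powr (4 * \<epsilon>) \<le> k" and p: "2 \<le> p"
  shows "\<exists>S. ennreal (real M ^ 5 / 64 * (1 / (16 * real M ^ 2)) powr p)
    \<le> (\<integral>\<^sup>+x. ennreal (norm (broad_part T k \<epsilon> (signed_strip M S) x) powr p)
          \<partial>restrict_space lborel (ball 0 (real M ^ 2)))"
proof -
  let ?P = "Pow {..<M\<^sup>2}"
  let ?l = "1 / (16 * real M ^ 2)"
  define g where "g S x = ennreal (norm (broad_part T k \<epsilon> (signed_strip M S) x) powr p)" for S x
  define I where "I S = (\<integral>\<^sup>+x. g S x * indicator (ball 0 (real M ^ 2)) x \<partial>lborel)" for S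
  have [measurable]: "g S \<in> borel_measurable borel" for S
    unfolding g_def using measurable_broad_part[OF M T a k] by measurable
  have "Max (I ` ?P) \<in> I ` ?P" by (intro Max_in) auto
  then obtain S where S: "I S = Max (I ` ?P)" by force
  have [measurable]: "slab M \<in> sets borel" by (simp add: slab_def)
  have [measurable]: "ball 0 (real M ^ 2) \<in> sets (borel :: (real^3) measure)" by simp
  have "ennreal (2 ^ (M\<^sup>2)) * ennreal (real M ^ 5 / 64 * ?l powr p)
      = (\<integral>\<^sup>+x. ennreal (2 ^ (M\<^sup>2) * ?l powr p) * indicator (slab M) x \<partial>lborel)"
    by (subst nn_integral_cmult_indicator)
       (simp_all add: emeasure_slab mult_ac flip: ennreal_mult)
  also have "\<dots> \<le> (\<integral>\<^sup>+x. (\<Sum>S\<in>?P. g S x * indicator (ball 0 (real M ^ 2)) x) \<partial>lborel)"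
  proof (intro nn_integral_mono)
    fix x
    show "ennreal (2 ^ (M\<^sup>2) * ?l powr p) * indicator (slab M) x
      \<le> (\<Sum>S\<in>?P. g S x * indicator (ball 0 (real M ^ 2)) x)"
    proof (cases "x \<in> slab M")
      case True
      then have "x \<in> ball 0 (real M ^ 2)" using slab_subset_ball[OF M] by auto
      then show ?thesis
        using broad_part_pth_moment[OF M k A T large True p] True
        by (simp add: g_def sum_ennreal ennreal_leI)
    qed simp
  qed
  also have "\<dots> = (\<Sum>S\<in>?P. I S)"
    unfolding I_def by (rule nn_integral_sum) measurable
  also have "\<dots> \<le> of_nat (card ?P) * I S"
    by (rule sum_bounded_above) (simp add: S)
  also have "\<dots> = ennreal (2 ^ (M\<^sup>2)) * I S"
    by (simp add: card_Pow ennreal_of_nat_eq_real_of_nat)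
  finally have "ennreal (real M ^ 5 / 64 * ?l powr p) \<le> I S"
    by (subst (asm) ennreal_mult_le_mult_iff) auto
  then show ?thesis
    by (intro exI[of _ S]) (simp add: I_def g_def nn_integral_restrict_space)
qed

section \<open>Norms of the signed strip\<close>

lemma norm_signed_strip_le:
  "norm (signed_strip M S \<omega>) \<le> (\<Sum>j<M\<^sup>2. indicator (cell M j) (horizontal \<omega>)) / sqrt (1 + (2 * norm (horizontal \<omega>))\<^sup>2)"
proof -
  have "\<bar>rademacher_sum {..<M\<^sup>2} S (\<lambda>j. indicator (cell M j) (horizontal \<omega>) :: real)\<bar>
      \<le> (\<Sum>j<M\<^sup>2. indicator (cell M j) (horizontal \<omega>))"
    unfolding rademacher_sum_def by (rule order_trans[OF sum_abs]) (intro sum_mono, auto simp: indicator_def)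
  then show ?thesis
    by (simp add: signed_cells_def norm_divide divide_right_mono)
qed

lemma sum_indicator_cells:
  "(\<Sum>j<M\<^sup>2. indicator (cell M j) y) = (indicator (\<Union>j<M\<^sup>2. cell M j) y :: real)"
  using disjoint_cells[of M] by (subst indicator_UN_disjoint) (auto simp: disjoint_family_on_def)

lemma norm_signed_strip_le_1: "norm (signed_strip M S \<omega>) \<le> 1"
proof -
  have "(indicator (\<Union>j<M\<^sup>2. cell M j) (horizontal \<omega>) :: real) / sqrt (1 + (2 * norm (horizontal \<omega>))\<^sup>2) \<le> 1 / 1"
    by (intro frac_le) (auto simp: indicator_def)
  then show ?thesis
    using norm_signed_strip_le[of M S \<omega>] unfolding sum_indicator_cells by simp
qed

lemma Linf_norm_signed_strip_le: "Linf_norm vol_paraboloid (signed_strip M S) \<le> 1"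
  unfolding Linf_norm_def
  by (intro esssup_I measurable_vol_paraboloid AE_I2)
     (auto simp: norm_signed_strip_le_1)

lemma signed_strip_Linf: "signed_strip M S \<in> Linf vol_paraboloid"
  using Linf_norm_signed_strip_le[of M S]
  by (auto simp: Linf_def intro!: measurable_vol_paraboloid measurable_signed_cells intro: order_le_less_trans)

text \<open>
With the area element \<open>s \<ge> 1\<close> the integrand is \<open>s (1/s)\<^sup>2 \<le> 1\<close> on the strip, whose area is \<open>1 / (4 M)\<close>.
\<close>

lemma nn_integral_square_signed_strip_le:
  assumes M: "M > 0"
  shows "(\<integral>\<^sup>+\<omega>. ennreal (norm (signed_strip M S \<omega>) powr 2) \<partial>vol_paraboloid) \<le> ennreal (1 / (4 * real M))"
proof -
  have "(\<integral>\<^sup>+\<omega>. ennreal (norm (signed_strip M S \<omega>) powr 2) \<partial>vol_paraboloid)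
    = (\<integral>\<^sup>+y. ennreal (sqrt (1 + (2 * norm y)\<^sup>2))
         * ennreal (norm (signed_strip M S (paraboloid_graph y)) powr 2) * indicator (ball 0 1) y \<partial>lborel)"
    by (rule nn_integral_vol_paraboloid) measurable
  also have "\<dots> \<le> (\<integral>\<^sup>+y. (\<Sum>j<M\<^sup>2. indicator (cell M j) y) \<partial>lborel)"
  proof (intro nn_integral_mono)
    fix y :: "real^2"
    define s where "s = sqrt (1 + (2 * norm y)\<^sup>2)"
    have s: "s \<ge> 1" by (simp add: s_def)
    let ?u = "indicator (\<Union>j<M\<^sup>2. cell M j) y :: real"
    let ?n = "norm (signed_strip M S (paraboloid_graph y))"
    have "?n \<le> ?u / s"
      using norm_signed_strip_le[of M S "paraboloid_graph y"] by (simp add: sum_indicator_cells s_def)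
    then have "s * ?n \<le> ?u"
      using s by (simp add: field_simps)
    then have "s * ?n * ?n \<le> ?u * 1"
      using s by (intro mult_mono norm_signed_strip_le_1) auto
    then have "ennreal (s * ?n powr 2) \<le> ennreal ?u"
      by (intro ennreal_leI) (simp add: power2_eq_square mult.assoc)
    moreover have "ennreal ?u = (\<Sum>j<M\<^sup>2. indicator (cell M j) y)"
      using disjoint_cells[of M] unfolding ennreal_indicator
      by (subst indicator_UN_disjoint) (auto simp: disjoint_family_on_def)
    moreover have "ennreal s * ennreal (?n powr 2) * indicator (ball 0 1) y \<le> ennreal (s * ?n powr 2)"
      using s by (auto simp: indicator_def ennreal_mult)
    ultimately show "ennreal (sqrt (1 + (2 * norm y)\<^sup>2)) * ennreal (?n powr 2) * indicator (ball 0 1) y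
        \<le> (\<Sum>j<M\<^sup>2. indicator (cell M j) y)"
      by (simp add: s_def)
  qed
  also have "\<dots> = (\<Sum>j<M\<^sup>2. emeasure lborel (cell M j))"
    by (subst nn_integral_sum) auto
  also have "\<dots> = (\<Sum>j<M\<^sup>2. ennreal (1 / (4 * real M ^ 3)))"
    using cell_fmeasurable[of M] measure_cell[OF M]
    by (intro sum.cong refl) (metis emeasure_eq_ennreal_measure fmeasurableD2 infinity_ennreal_def)
  also have "\<dots> = ennreal (\<Sum>j<M\<^sup>2. 1 / (4 * real M ^ 3))"
    by (rule sum_ennreal) auto
  also have "(\<Sum>j<M\<^sup>2. 1 / (4 * real M ^ 3)) = 1 / (4 * real M)"
    using M by (simp add: field_simps eval_nat_numeral)
  finally show ?thesis .
qed

section \<open>Comparison of both sides of the broad estimate\<close>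

lemma ennreal_powr_mono: "x \<le> y \<Longrightarrow> 0 \<le> a \<Longrightarrow> ennreal_powr x a \<le> ennreal_powr y a"
  by (auto simp: ennreal_powr_def top_unique less_top[symmetric] intro!: ennreal_leI powr_mono2 enn2real_mono)

lemma ennreal_powr_ennreal: "0 \<le> r \<Longrightarrow> ennreal_powr (ennreal r) a = ennreal (r powr a)"
  by (simp add: ennreal_powr_def)

text \<open>
With the radius \<open>R = M\<^sup>2\<close> the left-hand side of the estimate is at least of order
\<open>(M\<^sup>5)\<^bsup>1/p\<^esup> M\<^sup>-\<^sup>2\<close>, and the right-hand side is at most of order \<open>M\<^sup>2\<^sup>\<epsilon> (M\<^bsup>-1/2\<^esup>)\<^bsup>12/13\<^esup>\<close>.
\<close>

lemma broad_estimate_at_scale: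
  assumes M: "M > 0" and k: "k > 0" and a: "a > 0" and A: "A > 0" and T: "is_cap_partition a A k T"
    and large: "768 * A * k powr (4 * \<epsilon>) \<le> k" and p: "2 \<le> p" and c: "0 \<le> c"
    and estimate: "\<And>f. f \<in> Linf vol_paraboloid \<Longrightarrow>
         Lp_norm p (restrict_space lborel (ball 0 (real M ^ 2))) (broad_part T k \<epsilon> f)
           \<le> ennreal c * ennreal ((real M ^ 2) powr \<epsilon>)
              * ennreal_powr (Lp_norm 2 vol_paraboloid f) (12 / 13)
              * ennreal_powr (Linf_norm vol_paraboloid f) (1 / 13)"
  shows "real M powr (5 / p - 20 / 13 - 2 * \<epsilon>) \<le> 16 * 64 powr (1 / p) * c"
proof -
  define m where "m = real M"
  have m: "m > 0" using M by (simp add: m_def)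
  obtain S where S: "ennreal (m ^ 5 / 64 * (1 / (16 * m ^ 2)) powr p)
    \<le> (\<integral>\<^sup>+x. ennreal (norm (broad_part T k \<epsilon> (signed_strip M S) x) powr p)
          \<partial>restrict_space lborel (ball 0 (m ^ 2)))"
    unfolding m_def using exists_signs_broad_large[OF M k a A T large p] by blast
  let ?f = "signed_strip M S"
  have "ennreal ((m ^ 5 / 64 * (1 / (16 * m ^ 2)) powr p) powr (1 / p))
      \<le> Lp_norm p (restrict_space lborel (ball 0 (m ^ 2))) (broad_part T k \<epsilon> ?f)"
    unfolding Lp_norm_def using S p m
    by (subst ennreal_powr_ennreal[symmetric]) (auto intro!: ennreal_powr_mono)
  also have "\<dots> \<le> ennreal c * ennreal ((m ^ 2) powr \<epsilon>)
              * ennreal_powr (Lp_norm 2 vol_paraboloid ?f) (12 / 13)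
              * ennreal_powr (Linf_norm vol_paraboloid ?f) (1 / 13)"
    unfolding m_def by (rule estimate[OF signed_strip_Linf])
  also have "\<dots> \<le> ennreal c * ennreal ((m ^ 2) powr \<epsilon>)
              * ennreal_powr (ennreal_powr (ennreal (1 / (4 * m))) (1 / 2)) (12 / 13)
              * ennreal_powr (ennreal 1) (1 / 13)"
    unfolding Lp_norm_def m_def
    by (intro mult_mono ennreal_powr_mono nn_integral_square_signed_strip_le M order_refl)
       (auto simp: Linf_norm_signed_strip_le)
  also have "\<dots> = ennreal (c * (m ^ 2) powr \<epsilon> * ((1 / (4 * m)) powr (1 / 2)) powr (12 / 13))"
    using m c ennreal_powr_ennreal[of 1 "1 / 13"] by (simp add: ennreal_powr_ennreal ennreal_mult)
  finally have le: "(m ^ 5 / 64 * (1 / (16 * m ^ 2)) powr p) powr (1 / p)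
      \<le> c * (m ^ 2) powr \<epsilon> * ((1 / (4 * m)) powr (1 / 2)) powr (12 / 13)"
    using c by (simp add: ennreal_le_iff)
  have m5: "(m ^ 5) powr (1 / p) = m powr (5 / p)"
  proof -
    have "m ^ 5 = m powr 5" using m by simp
    then show ?thesis by (simp only: powr_powr) simp
  qed
  have m2: "(m ^ 2) powr \<epsilon> = m powr (2 * \<epsilon>)"
  proof -
    have "m ^ 2 = m powr 2" using m by simp
    then show ?thesis by (simp only: powr_powr)
  qed
  have "(m ^ 5 / 64 * (1 / (16 * m ^ 2)) powr p) powr (1 / p)
      = (m ^ 5) powr (1 / p) / 64 powr (1 / p) * ((1 / (16 * m ^ 2)) powr p) powr (1 / p)"
    using m by (subst powr_mult) (auto simp: powr_divide)
  also have "\<dots> = m powr (5 / p) / 64 powr (1 / p) * (1 / (16 * m ^ 2))"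
    using m p unfolding m5 powr_powr by simp
  also have "\<dots> = m powr (5 / p - 2) / (16 * 64 powr (1 / p))"
    using m by (simp add: powr_diff)
  finally have lhs: "(m ^ 5 / 64 * (1 / (16 * m ^ 2)) powr p) powr (1 / p)
      = m powr (5 / p - 2) / (16 * 64 powr (1 / p))" .
  have "c * (m ^ 2) powr \<epsilon> * ((1 / (4 * m)) powr (1 / 2)) powr (12 / 13)
      = c * m powr (2 * \<epsilon>) * (1 / (4 * m)) powr (6 / 13)"
    unfolding m2 powr_powr by simp
  also have "\<dots> = c * m powr (2 * \<epsilon>) * (1 / (4 powr (6 / 13) * m powr (6 / 13)))"
    using m by (subst powr_divide) (auto simp: powr_mult)
  also have "\<dots> \<le> c * m powr (2 * \<epsilon>) * (1 / (1 * m powr (6 / 13)))"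
    using m c by (intro mult_left_mono frac_le mult_right_mono ge_one_powr_ge_zero) auto
  also have "\<dots> = c * m powr (2 * \<epsilon> - 6 / 13)"
    by (simp add: powr_diff)
  finally have "m powr (5 / p - 2) / (16 * 64 powr (1 / p)) \<le> c * m powr (2 * \<epsilon> - 6 / 13)"
    using le unfolding lhs by (rule order_trans[rotated])
  then have "m powr (5 / p - 2) \<le> 16 * 64 powr (1 / p) * (c * m powr (2 * \<epsilon> - 6 / 13))"
    by (simp add: pos_divide_le_eq mult_ac)
  then have "m powr (5 / p - 2) / m powr (2 * \<epsilon> - 6 / 13) \<le> 16 * 64 powr (1 / p) * c"
    using m by (simp add: field_simps)
  also have "m powr (5 / p - 2) / m powr (2 * \<epsilon> - 6 / 13) = m powr (5 / p - 20 / 13 - 2 * \<epsilon>)"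
    by (simp add: powr_diff[symmetric] algebra_simps)
  finally show ?thesis by (simp add: m_def)
qed

theorem theorem2p1:
  fixes a A :: real
    and caps :: "real \<Rightarrow> (real^3) set set"
    and p :: real
    and K :: "real \<Rightarrow> real"
    and C :: "real \<Rightarrow> ennreal"
  assumes constants: "0 < a" "0 < A"
    and caps: "\<And>k. k > 1 \<Longrightarrow> is_cap_partition a A k (caps k)"
    and p: "3 \<le> p"
    and K_gt_1: "\<And>\<epsilon>. \<epsilon> > 0 \<Longrightarrow> K \<epsilon> > 1"
    and C_finite: "\<And>\<epsilon>. \<epsilon> > 0 \<Longrightarrow> C \<epsilon> < \<infinity>"
    and broad_estimate:
      "\<And>\<epsilon> R f. \<epsilon> > 0 \<Longrightarrow> R \<ge> 1 \<Longrightarrow> f \<in> Linf vol_paraboloid \<Longrightarrow>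
         Lp_norm p (restrict_space lborel (ball 0 R)) (broad_part (caps (K \<epsilon>)) (K \<epsilon>) \<epsilon> f)
           \<le> C \<epsilon> * ennreal (R powr \<epsilon>)
              * ennreal_powr (Lp_norm 2 vol_paraboloid f) (12 / 13)
              * ennreal_powr (Linf_norm vol_paraboloid f) (1 / 13)"
    and K_lim: "filterlim K at_top (at_right 0)"
  shows "p \<ge> 13 / 4"
proof (rule ccontr)
  assume "\<not> p \<ge> 13 / 4"
  then have p': "p < 13 / 4" by simp
  define \<gamma> where "\<gamma> = 5 / p - 20 / 13"
  have \<gamma>: "\<gamma> > 0" using p p' by (simp add: \<gamma>_def field_simps)
  have "\<forall>\<^sub>F \<epsilon> in at_right 0. (768 * A)\<^sup>2 \<le> K \<epsilon>"
    using K_lim by (simp add: filterlim_at_top)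
  moreover have "\<forall>\<^sub>F \<epsilon> in at_right 0. 0 < \<epsilon> \<and> \<epsilon> < min (1 / 8) (\<gamma> / 4)"
    using \<gamma> by (auto simp: eventually_at_right_field intro!: exI[of _ "min (1 / 8) (\<gamma> / 4)"])
  ultimately have "\<forall>\<^sub>F \<epsilon> in at_right (0::real). (768 * A)\<^sup>2 \<le> K \<epsilon> \<and> 0 < \<epsilon> \<and> \<epsilon> < min (1 / 8) (\<gamma> / 4)"
    by eventually_elim simp
  \<comment> \<open>\<open>\<epsilon> < 1/8\<close> leaves room for \<open>K\<^sup>4\<^sup>\<epsilon> \<le> K\<^bsup>1/2\<^esup>\<close>, and \<open>\<epsilon> < \<gamma>/4\<close> keeps half of the excess exponent \<open>\<gamma>\<close>.\<close>
  then obtain \<epsilon> where \<epsilon>: "(768 * A)\<^sup>2 \<le> K \<epsilon>" "0 < \<epsilon>" "\<epsilon> < 1 / 8" "\<epsilon> < \<gamma> / 4"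
    using eventually_happens[of _ "at_right (0::real)"] by (auto simp: trivial_limit_at_right_real)
  define k where "k = K \<epsilon>"
  have k: "k > 1" using K_gt_1 \<epsilon> by (simp add: k_def)
  have large: "768 * A * k powr (4 * \<epsilon>) \<le> k"
  proof -
    have "768 * A \<le> k powr (1 / 2)"
      using \<epsilon>(1) k by (simp add: powr_half_sqrt real_le_rsqrt k_def)
    moreover have "k powr (4 * \<epsilon>) \<le> k powr (1 / 2)"
      using \<epsilon>(3) k by (intro powr_mono) auto
    ultimately have "768 * A * k powr (4 * \<epsilon>) \<le> k powr (1 / 2) * k powr (1 / 2)"
      using constants by (intro mult_mono) auto
    also have "\<dots> = k" using k by (simp flip: powr_add)
    finally show ?thesis .
  qed
  obtain c where c: "C \<epsilon> = ennreal c" "c \<ge> 0"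
    using C_finite[OF \<epsilon>(2)] by (cases "C \<epsilon>") auto
  have "real M powr (\<gamma> / 2) \<le> 16 * 64 powr (1 / p) * c" if M: "M > 0" for M
  proof -
    have "real M powr (\<gamma> / 2) \<le> real M powr (\<gamma> - 2 * \<epsilon>)"
      using M \<epsilon> by (intro powr_mono) auto
    also have "\<dots> \<le> 16 * 64 powr (1 / p) * c"
      unfolding \<gamma>_def
    proof (rule broad_estimate_at_scale[OF M _ constants caps[OF k] large])
      fix f :: "real^3 \<Rightarrow> complex" assume "f \<in> Linf vol_paraboloid"
      moreover have "real M ^ 2 \<ge> 1" using M by simp
      ultimately show "Lp_norm p (restrict_space lborel (ball 0 (real M ^ 2))) (broad_part (caps k) k \<epsilon> f)
           \<le> ennreal c * ennreal ((real M ^ 2) powr \<epsilon>)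
              * ennreal_powr (Lp_norm 2 vol_paraboloid f) (12 / 13)
              * ennreal_powr (Linf_norm vol_paraboloid f) (1 / 13)"
        using broad_estimate[OF \<epsilon>(2)] c(1) by (simp add: k_def)
    qed (use k p c in auto)
    finally show ?thesis .
  qed
  note bounded = this
  define B where "B = 16 * 64 powr (1 / p) * c + 1"
  have B: "B > 0" using c(2) by (simp add: B_def add_nonneg_pos)
  obtain M :: nat where M: "B powr (2 / \<gamma>) < real M"
    using reals_Archimedean2 by blast
  then have "0 < real M" using powr_ge_zero[of B "2 / \<gamma>"] by linarith
  then have "M > 0" by simp
  have "B = (B powr (2 / \<gamma>)) powr (\<gamma> / 2)"
    using B \<gamma> by (simp add: powr_powr)
  also have "\<dots> < real M powr (\<gamma> / 2)"
    using M \<gamma> by (intro powr_less_mono2) auto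
  finally show False
    using bounded[OF \<open>M > 0\<close>] by (simp add: B_def)
qed

end
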